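(* The following data define a lax symmetric monoidal functor $\mathsf{FlowNet}\colon(\mathbf{FinSet},+)\to(\mathbf{Set},\times)$ (with flow networks regarded up to relabelling of edges, i.e. with the required diagrams holding up to canonical isomorphism of edge sets). (i) On objects, $\mathsf{FlowNet}$ takes a finite set $N$ to the set of flow networks with vertex set $N$. (ii) For a function $\phi\colon N\to M$, the map $\mathsf{FlowNet}(\phi)\colon\mathsf{FlowNet}(N)\to\mathsf{FlowNet}(M)$ is $(E,s,t,\ell,b)\mapsto(E,\phi\circ s,\phi\circ t,\ell,\phi_*(b))$. (iii) The unit comparison $\varphi_0\colon\{*\}\to\mathsf{FlowNet}(\emptyset)$ is the unique map, $\mathsf{FlowNet}(\emptyset)$ being a singleton. (iv) For finite sets $N,M$, the product comparison $\varphi_{N,M}\colon\mathsf{FlowNet}(N)\times\mathsf{FlowNet}(M)\to\mathsf{FlowNet}(N+M)$ takes $(E_1,s_1,t_1,\ell_1,b_1)$ and $(E_2,s_2,t_2,\ell_2,b_2)$ to their disjoint union $(E_1+E_2,\,s_1+s_2,\,t_1+t_2,\,[\ell_1,\ell_2],\,[b_1,b_2])$.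
   Context: $(\mathbf{FinSet},+)$ is finite sets with disjoint union as monoidal product; $(\mathbf{Set},\times)$ is sets with Cartesian product. Let $K=\{\kappa\colon\mathbb{R}\to\mathbb{R}\mid\kappa\in C^1\text{ and convex}\}$. A flow network on a finite vertex set $N$ is a tuple $(E,s,t,\ell,b)$ with $E$ a finite set (edges), $s,t\colon E\to N$ (source and target), $\ell\colon E\to K$ (edge costs), and $b\colon N\to\mathbb{R}$ (inflows/outflows) satisfying $\mathbf{1}^Tb=\sum_{n\in N}b(n)=0$. Two flow networks on $N$ differ by a relabelling of edges if there is a bijection of edge sets compatible with $s,t,\ell$ (and they have the same $b$). For $\phi\colon N\to M$, $\phi_*\colon\mathbb{R}^N\to\mathbb{R}^M$ is $\phi_*(x)_j=\sum_{i\in\phi^{-1}(j)}x_i$. $[\cdot,\cdot]$ denotes copairing out of a disjoint union. *)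

theory Defs
  imports "HOL-Analysis.Analysis"
begin

section \<open>Symmetric monoidal categories and lax symmetric monoidal functors\<close>

record ('o, 'm) sm_cat =
  Obj :: "'o set"
  Arr :: "'m set"
  Dom :: "'m \<Rightarrow> 'o"
  Cod :: "'m \<Rightarrow> 'o"
  Ident :: "'o \<Rightarrow> 'm"
  Comp :: "'m \<Rightarrow> 'm \<Rightarrow> 'm"
  Tensor :: "'o \<Rightarrow> 'o \<Rightarrow> 'o"
  TensorArr :: "'m \<Rightarrow> 'm \<Rightarrow> 'm"
  Unit :: "'o"
  Assoc :: "'o \<Rightarrow> 'o \<Rightarrow> 'o \<Rightarrow> 'm"
  LUnit :: "'o \<Rightarrow> 'm"
  RUnit :: "'o \<Rightarrow> 'm"
  Braid :: "'o \<Rightarrow> 'o \<Rightarrow> 'm"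

text \<open>\<open>Comp C g f\<close> is \<open>g \<circ> f\<close>; \<open>Assoc C X Y Z\<close> goes from \<open>(X \<otimes> Y) \<otimes> Z\<close> to \<open>X \<otimes> (Y \<otimes> Z)\<close>.\<close>

definition Hom :: "('o, 'm) sm_cat \<Rightarrow> 'o \<Rightarrow> 'o \<Rightarrow> 'm set" where
  "Hom C X Y = {f \<in> Arr C. Dom C f = X \<and> Cod C f = Y}"

definition iso_arrow :: "('o, 'm) sm_cat \<Rightarrow> 'o \<Rightarrow> 'o \<Rightarrow> 'm \<Rightarrow> bool" where
  "iso_arrow C X Y f \<longleftrightarrow> f \<in> Hom C X Y \<and>
     (\<exists>g \<in> Hom C Y X. Comp C g f = Ident C X \<and> Comp C f g = Ident C Y)"

locale category =
  fixes C :: "('o, 'm) sm_cat"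
  assumes dom_obj: "f \<in> Arr C \<Longrightarrow> Dom C f \<in> Obj C"
    and cod_obj: "f \<in> Arr C \<Longrightarrow> Cod C f \<in> Obj C"
    and ident_hom: "X \<in> Obj C \<Longrightarrow> Ident C X \<in> Hom C X X"
    and comp_hom: "\<lbrakk>f \<in> Hom C X Y; g \<in> Hom C Y Z\<rbrakk> \<Longrightarrow> Comp C g f \<in> Hom C X Z"
    and comp_assoc: "\<lbrakk>f \<in> Hom C X Y; g \<in> Hom C Y Z; h \<in> Hom C Z W\<rbrakk>
      \<Longrightarrow> Comp C h (Comp C g f) = Comp C (Comp C h g) f"
    and comp_ident_left: "f \<in> Hom C X Y \<Longrightarrow> Comp C (Ident C Y) f = f"
    and comp_ident_right: "f \<in> Hom C X Y \<Longrightarrow> Comp C f (Ident C X) = f"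

locale symmetric_monoidal_category = category C for C :: "('o, 'm) sm_cat" +
  assumes unit_obj: "Unit C \<in> Obj C"
    and tensor_obj: "\<lbrakk>X \<in> Obj C; Y \<in> Obj C\<rbrakk> \<Longrightarrow> Tensor C X Y \<in> Obj C"
    and tensor_hom: "\<lbrakk>f \<in> Hom C X X'; g \<in> Hom C Y Y'\<rbrakk>
      \<Longrightarrow> TensorArr C f g \<in> Hom C (Tensor C X Y) (Tensor C X' Y')"
    and tensor_ident: "\<lbrakk>X \<in> Obj C; Y \<in> Obj C\<rbrakk>
      \<Longrightarrow> TensorArr C (Ident C X) (Ident C Y) = Ident C (Tensor C X Y)"
    and tensor_comp: "\<lbrakk>f \<in> Hom C X X'; f' \<in> Hom C X' X''; g \<in> Hom C Y Y'; g' \<in> Hom C Y' Y''\<rbrakk>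
      \<Longrightarrow> TensorArr C (Comp C f' f) (Comp C g' g) =
          Comp C (TensorArr C f' g') (TensorArr C f g)"
    and assoc_iso: "\<lbrakk>X \<in> Obj C; Y \<in> Obj C; Z \<in> Obj C\<rbrakk>
      \<Longrightarrow> iso_arrow C (Tensor C (Tensor C X Y) Z) (Tensor C X (Tensor C Y Z)) (Assoc C X Y Z)"
    and assoc_natural: "\<lbrakk>f \<in> Hom C X X'; g \<in> Hom C Y Y'; h \<in> Hom C Z Z'\<rbrakk>
      \<Longrightarrow> Comp C (Assoc C X' Y' Z') (TensorArr C (TensorArr C f g) h) =
          Comp C (TensorArr C f (TensorArr C g h)) (Assoc C X Y Z)"
    and lunit_iso: "X \<in> Obj C \<Longrightarrow> iso_arrow C (Tensor C (Unit C) X) X (LUnit C X)"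
    and lunit_natural: "f \<in> Hom C X X'
      \<Longrightarrow> Comp C (LUnit C X') (TensorArr C (Ident C (Unit C)) f) = Comp C f (LUnit C X)"
    and runit_iso: "X \<in> Obj C \<Longrightarrow> iso_arrow C (Tensor C X (Unit C)) X (RUnit C X)"
    and runit_natural: "f \<in> Hom C X X'
      \<Longrightarrow> Comp C (RUnit C X') (TensorArr C f (Ident C (Unit C))) = Comp C f (RUnit C X)"
    and braid_hom: "\<lbrakk>X \<in> Obj C; Y \<in> Obj C\<rbrakk>
      \<Longrightarrow> Braid C X Y \<in> Hom C (Tensor C X Y) (Tensor C Y X)"
    and braid_natural: "\<lbrakk>f \<in> Hom C X X'; g \<in> Hom C Y Y'\<rbrakk>
      \<Longrightarrow> Comp C (Braid C X' Y') (TensorArr C f g) = Comp C (TensorArr C g f) (Braid C X Y)"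
    and braid_symmetric: "\<lbrakk>X \<in> Obj C; Y \<in> Obj C\<rbrakk>
      \<Longrightarrow> Comp C (Braid C Y X) (Braid C X Y) = Ident C (Tensor C X Y)"
    and pentagon: "\<lbrakk>W \<in> Obj C; X \<in> Obj C; Y \<in> Obj C; Z \<in> Obj C\<rbrakk>
      \<Longrightarrow> Comp C (Assoc C W X (Tensor C Y Z)) (Assoc C (Tensor C W X) Y Z) =
          Comp C (TensorArr C (Ident C W) (Assoc C X Y Z))
            (Comp C (Assoc C W (Tensor C X Y) Z) (TensorArr C (Assoc C W X Y) (Ident C Z)))"
    and triangle: "\<lbrakk>X \<in> Obj C; Y \<in> Obj C\<rbrakk>
      \<Longrightarrow> Comp C (TensorArr C (Ident C X) (LUnit C Y)) (Assoc C X (Unit C) Y) =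
          TensorArr C (RUnit C X) (Ident C Y)"
    and hexagon: "\<lbrakk>X \<in> Obj C; Y \<in> Obj C; Z \<in> Obj C\<rbrakk>
      \<Longrightarrow> Comp C (Assoc C Y Z X) (Comp C (Braid C X (Tensor C Y Z)) (Assoc C X Y Z)) =
          Comp C (TensorArr C (Ident C Y) (Braid C X Z))
            (Comp C (Assoc C Y X Z) (TensorArr C (Braid C X Y) (Ident C Z)))"

locale cat_functor = C: category C + D: category D
  for C :: "('o1, 'm1) sm_cat" and D :: "('o2, 'm2) sm_cat" +
  fixes Fo :: "'o1 \<Rightarrow> 'o2" and Fm :: "'m1 \<Rightarrow> 'm2"
  assumes functor_obj: "X \<in> Obj C \<Longrightarrow> Fo X \<in> Obj D"
    and functor_hom: "f \<in> Hom C X Y \<Longrightarrow> Fm f \<in> Hom D (Fo X) (Fo Y)"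
    and functor_ident: "X \<in> Obj C \<Longrightarrow> Fm (Ident C X) = Ident D (Fo X)"
    and functor_comp: "\<lbrakk>f \<in> Hom C X Y; g \<in> Hom C Y Z\<rbrakk>
      \<Longrightarrow> Fm (Comp C g f) = Comp D (Fm g) (Fm f)"

locale lax_symmetric_monoidal_functor =
  cat_functor C D Fo Fm + C: symmetric_monoidal_category C + D: symmetric_monoidal_category D
  for C :: "('o1, 'm1) sm_cat" and D :: "('o2, 'm2) sm_cat"
    and Fo :: "'o1 \<Rightarrow> 'o2" and Fm :: "'m1 \<Rightarrow> 'm2" +
  fixes unit_cmp :: "'m2" and prod_cmp :: "'o1 \<Rightarrow> 'o1 \<Rightarrow> 'm2"
  assumes unit_cmp_hom: "unit_cmp \<in> Hom D (Unit D) (Fo (Unit C))"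
    and prod_cmp_hom: "\<lbrakk>X \<in> Obj C; Y \<in> Obj C\<rbrakk>
      \<Longrightarrow> prod_cmp X Y \<in> Hom D (Tensor D (Fo X) (Fo Y)) (Fo (Tensor C X Y))"
    and prod_cmp_natural: "\<lbrakk>f \<in> Hom C X X'; g \<in> Hom C Y Y'\<rbrakk>
      \<Longrightarrow> Comp D (Fm (TensorArr C f g)) (prod_cmp X Y) =
          Comp D (prod_cmp X' Y') (TensorArr D (Fm f) (Fm g))"
    and prod_cmp_assoc: "\<lbrakk>X \<in> Obj C; Y \<in> Obj C; Z \<in> Obj C\<rbrakk>
      \<Longrightarrow> Comp D (Fm (Assoc C X Y Z))
            (Comp D (prod_cmp (Tensor C X Y) Z)
              (TensorArr D (prod_cmp X Y) (Ident D (Fo Z)))) =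
          Comp D (prod_cmp X (Tensor C Y Z))
            (Comp D (TensorArr D (Ident D (Fo X)) (prod_cmp Y Z))
              (Assoc D (Fo X) (Fo Y) (Fo Z)))"
    and prod_cmp_lunit: "X \<in> Obj C
      \<Longrightarrow> Comp D (Fm (LUnit C X))
            (Comp D (prod_cmp (Unit C) X) (TensorArr D unit_cmp (Ident D (Fo X)))) =
          LUnit D (Fo X)"
    and prod_cmp_runit: "X \<in> Obj C
      \<Longrightarrow> Comp D (Fm (RUnit C X))
            (Comp D (prod_cmp X (Unit C)) (TensorArr D (Ident D (Fo X)) unit_cmp)) =
          RUnit D (Fo X)"
    and prod_cmp_braid: "\<lbrakk>X \<in> Obj C; Y \<in> Obj C\<rbrakk>
      \<Longrightarrow> Comp D (Fm (Braid C X Y)) (prod_cmp X Y) =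
          Comp D (prod_cmp Y X) (Braid D (Fo X) (Fo Y))"


section \<open>Finite sets with disjoint union, sets with Cartesian product\<close>

text \<open>
  HOL has no set of all sets, so objects are subsets of a universe type: \<open>'a sum_univ\<close> is the
  closure of an arbitrary type \<open>'a\<close> under binary disjoint union, \<open>'b prod_univ\<close> the closure of
  \<open>'b\<close> and a point under binary product. Every set of elements of \<open>'a\<close> (of \<open>'b\<close>) occurs,
  through \<open>Atom\<close> (\<open>Elem\<close>), and the type parameters are arbitrary throughout.
\<close>

datatype 'a sum_univ = Atom 'a | Lft "'a sum_univ" | Rgt "'a sum_univ"

datatype 'b prod_univ = Elem 'b | Star | PairOf "'b prod_univ" "'b prod_univ"

definition disj_sum :: "'a sum_univ set \<Rightarrow> 'a sum_univ set \<Rightarrow> 'a sum_univ set" where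
  "disj_sum A B = Lft ` A \<union> Rgt ` B"

text \<open>
  \<open>copair f g\<close> is the copairing \<open>[f, g]\<close> on a disjoint union; the value at an \<open>Atom\<close>, which lies in
  no disjoint union, is \<open>undefined\<close>, so that copairings of extensional functions are extensional.
\<close>

definition copair :: "('a sum_univ \<Rightarrow> 'c) \<Rightarrow> ('a sum_univ \<Rightarrow> 'c) \<Rightarrow> 'a sum_univ \<Rightarrow> 'c" where
  "copair f g u = (case u of Lft x \<Rightarrow> f x | Rgt y \<Rightarrow> g y | Atom _ \<Rightarrow> undefined)"

definition sum_assoc :: "'a sum_univ \<Rightarrow> 'a sum_univ" where
  "sum_assoc = copair (copair Lft (Rgt \<circ> Lft)) (Rgt \<circ> Rgt)"

definition sum_lunit :: "'a sum_univ \<Rightarrow> 'a sum_univ" where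
  "sum_lunit = copair (\<lambda>_. undefined) id"

definition sum_runit :: "'a sum_univ \<Rightarrow> 'a sum_univ" where
  "sum_runit = copair id (\<lambda>_. undefined)"

definition sum_swap :: "'a sum_univ \<Rightarrow> 'a sum_univ" where
  "sum_swap = copair Rgt Lft"

definition cart_prod :: "'b prod_univ set \<Rightarrow> 'b prod_univ set \<Rightarrow> 'b prod_univ set" where
  "cart_prod A B = {PairOf a b | a b. a \<in> A \<and> b \<in> B}"

fun pair_map :: "('b prod_univ \<Rightarrow> 'b prod_univ) \<Rightarrow> ('b prod_univ \<Rightarrow> 'b prod_univ) \<Rightarrow>
    'b prod_univ \<Rightarrow> 'b prod_univ" where
  "pair_map f g (PairOf a b) = PairOf (f a) (g b)"
| "pair_map f g _ = undefined"

fun pair_assoc :: "'b prod_univ \<Rightarrow> 'b prod_univ" where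
  "pair_assoc (PairOf (PairOf a b) c) = PairOf a (PairOf b c)"
| "pair_assoc _ = undefined"

fun pair_fst :: "'b prod_univ \<Rightarrow> 'b prod_univ" where
  "pair_fst (PairOf a b) = a"
| "pair_fst _ = undefined"

fun pair_snd :: "'b prod_univ \<Rightarrow> 'b prod_univ" where
  "pair_snd (PairOf a b) = b"
| "pair_snd _ = undefined"

fun pair_swap :: "'b prod_univ \<Rightarrow> 'b prod_univ" where
  "pair_swap (PairOf a b) = PairOf b a"
| "pair_swap _ = undefined"

text \<open>
  A map of sets is stored with its domain and codomain, and its function is extensional
  (\<open>undefined\<close> outside the domain), so that equality of arrows is equality of maps.
\<close>

record 'u set_map =
  src :: "'u set"
  tgt :: "'u set"
  fn :: "'u \<Rightarrow> 'u"

definition mk_map :: "'u set \<Rightarrow> 'u set \<Rightarrow> ('u \<Rightarrow> 'u) \<Rightarrow> 'u set_map" where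
  "mk_map A B f = \<lparr>src = A, tgt = B, fn = restrict f A\<rparr>"

definition FinSet :: "('a sum_univ set, 'a sum_univ set_map) sm_cat" where
  "FinSet = \<lparr>
     Obj = {A. finite A},
     Arr = {f. finite (src f) \<and> finite (tgt f) \<and> fn f \<in> src f \<rightarrow>\<^sub>E tgt f},
     Dom = src,
     Cod = tgt,
     Ident = (\<lambda>A. mk_map A A id),
     Comp = (\<lambda>g f. mk_map (src f) (tgt g) (fn g \<circ> fn f)),
     Tensor = disj_sum,
     TensorArr = (\<lambda>f g. mk_map (disj_sum (src f) (src g)) (disj_sum (tgt f) (tgt g))
       (copair (Lft \<circ> fn f) (Rgt \<circ> fn g))),
     Unit = {},
     Assoc = (\<lambda>A B C. mk_map (disj_sum (disj_sum A B) C) (disj_sum A (disj_sum B C)) sum_assoc),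
     LUnit = (\<lambda>A. mk_map (disj_sum {} A) A sum_lunit),
     RUnit = (\<lambda>A. mk_map (disj_sum A {}) A sum_runit),
     Braid = (\<lambda>A B. mk_map (disj_sum A B) (disj_sum B A) sum_swap)\<rparr>"

definition SetCat :: "('b prod_univ set, 'b prod_univ set_map) sm_cat" where
  "SetCat = \<lparr>
     Obj = UNIV,
     Arr = {f. fn f \<in> src f \<rightarrow>\<^sub>E tgt f},
     Dom = src,
     Cod = tgt,
     Ident = (\<lambda>A. mk_map A A id),
     Comp = (\<lambda>g f. mk_map (src f) (tgt g) (fn g \<circ> fn f)),
     Tensor = cart_prod,
     TensorArr = (\<lambda>f g. mk_map (cart_prod (src f) (src g)) (cart_prod (tgt f) (tgt g))
       (pair_map (fn f) (fn g))),
     Unit = {Star},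
     Assoc = (\<lambda>A B C.
       mk_map (cart_prod (cart_prod A B) C) (cart_prod A (cart_prod B C)) pair_assoc),
     LUnit = (\<lambda>A. mk_map (cart_prod {Star} A) A pair_snd),
     RUnit = (\<lambda>A. mk_map (cart_prod A {Star}) A pair_fst),
     Braid = (\<lambda>A B. mk_map (cart_prod A B) (cart_prod B A) pair_swap)\<rparr>"


section \<open>Flow networks\<close>

definition edge_costs :: "(real \<Rightarrow> real) set" where
  "edge_costs = {\<kappa>. \<kappa> C1_differentiable_on UNIV \<and> convex_on UNIV \<kappa>}"

record ('n, 'e) flow_network =
  edges :: "'e set"
  source :: "'e \<Rightarrow> 'n"
  target :: "'e \<Rightarrow> 'n"
  cost :: "'e \<Rightarrow> real \<Rightarrow> real"
  inflow :: "'n \<Rightarrow> real"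

definition flow_networks :: "'n set \<Rightarrow> ('n, 'e) flow_network set" where
  "flow_networks N = {F. finite (edges F) \<and>
     source F \<in> edges F \<rightarrow>\<^sub>E N \<and>
     target F \<in> edges F \<rightarrow>\<^sub>E N \<and>
     cost F \<in> edges F \<rightarrow>\<^sub>E edge_costs \<and>
     inflow F \<in> N \<rightarrow>\<^sub>E UNIV \<and>
     (\<Sum>n\<in>N. inflow F n) = 0}"

definition relabelling ::
    "('e \<Rightarrow> 'e) \<Rightarrow> ('n, 'e) flow_network \<Rightarrow> ('n, 'e) flow_network \<Rightarrow> bool" where
  "relabelling r F F' \<longleftrightarrow> bij_betw r (edges F) (edges F') \<and>
     (\<forall>e\<in>edges F. source F' (r e) = source F e \<and> target F' (r e) = target F e \<and>
                  cost F' (r e) = cost F e) \<and>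
     inflow F' = inflow F"

definition relabel_rel :: "'n set \<Rightarrow> (('n, 'e) flow_network \<times> ('n, 'e) flow_network) set" where
  "relabel_rel N = {(F, F'). F \<in> flow_networks N \<and> F' \<in> flow_networks N \<and>
     (\<exists>r. relabelling r F F')}"

definition push_vec :: "'n set_map \<Rightarrow> ('n \<Rightarrow> real) \<Rightarrow> 'n \<Rightarrow> real" where
  "push_vec \<phi> x = (\<lambda>j\<in>tgt \<phi>. \<Sum>i\<in>{i \<in> src \<phi>. fn \<phi> i = j}. x i)"

definition push_network ::
    "'n set_map \<Rightarrow> ('n, 'e) flow_network \<Rightarrow> ('n, 'e) flow_network" where
  "push_network \<phi> F = \<lparr>
     edges = edges F,
     source = restrict (fn \<phi> \<circ> source F) (edges F),
     target = restrict (fn \<phi> \<circ> target F) (edges F),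
     cost = cost F,
     inflow = push_vec \<phi> (inflow F)\<rparr>"

type_synonym ('a, 'e) network = "('a sum_univ, 'e sum_univ) flow_network"

definition sum_network :: "('a, 'e) network \<Rightarrow> ('a, 'e) network \<Rightarrow> ('a, 'e) network" where
  "sum_network F G = \<lparr>
     edges = disj_sum (edges F) (edges G),
     source = restrict (copair (Lft \<circ> source F) (Rgt \<circ> source G)) (disj_sum (edges F) (edges G)),
     target = restrict (copair (Lft \<circ> target F) (Rgt \<circ> target G)) (disj_sum (edges F) (edges G)),
     cost = copair (cost F) (cost G),
     inflow = copair (inflow F) (inflow G)\<rparr>"


section \<open>The functor of flow networks up to relabelling of edges\<close>

definition network_class :: "'a sum_univ set \<Rightarrow> ('a, 'e) network \<Rightarrow> ('a, 'e) network set" where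
  "network_class N F = relabel_rel N `` {F}"

type_synonym ('a, 'e) network_univ = "('a, 'e) network set prod_univ"

definition FlowNet :: "'a sum_univ set \<Rightarrow> ('a, 'e) network_univ set" where
  "FlowNet N = Elem ` (flow_networks N // relabel_rel N)"

text \<open>
  Maps out of a quotient are given by a union over the representatives of a class, as usual
  for \<^const>\<open>quotient\<close>.
\<close>

definition FlowNet_map :: "'a sum_univ set_map \<Rightarrow> ('a, 'e) network_univ set_map" where
  "FlowNet_map \<phi> = mk_map (FlowNet (src \<phi>)) (FlowNet (tgt \<phi>))
     (\<lambda>u. case u of Elem X \<Rightarrow> Elem (\<Union>F\<in>X. network_class (tgt \<phi>) (push_network \<phi> F))
        | _ \<Rightarrow> undefined)"

definition FlowNet_unit :: "('a, 'e) network_univ set_map" where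
  "FlowNet_unit = (THE f. f \<in> Hom SetCat {Star} (FlowNet {}))"

definition FlowNet_prod ::
    "'a sum_univ set \<Rightarrow> 'a sum_univ set \<Rightarrow> ('a, 'e) network_univ set_map" where
  "FlowNet_prod N M = mk_map (cart_prod (FlowNet N) (FlowNet M)) (FlowNet (disj_sum N M))
     (\<lambda>u. case u of
          PairOf (Elem X) (Elem Y) \<Rightarrow>
            Elem (\<Union>F\<in>X. \<Union>G\<in>Y. network_class (disj_sum N M) (sum_network F G))
        | _ \<Rightarrow> undefined)"

end

theory Submission
  imports Defs
begin

text \<open>
  A flow network consists of a set of edges decorated with sources, targets and costs, and a vector
  of inflows. A map of vertices acts on sources and targets by composition and on the inflows by
  \<open>push_vec\<close>.
  Two properties of \<open>push_vec\<close> carry the proof. Regrouping a sum along the fibres of a map makes it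
  functorial and keeps the total inflow at zero (\<open>push_vec_comp\<close>, \<open>sum_push_vec\<close>); fibres in
  different summands do not meet, so it commutes with copairing (\<open>push_vec_copair\<close>).
  Hence functoriality and naturality of the comparison maps hold strictly, as equations between
  networks (\<open>push_network_ident\<close>, \<open>push_network_comp\<close>, \<open>push_network_tensor\<close>).

  The coherence diagrams do not commute strictly: their two sides are networks with different edge
  sets, such as those of the two bracketings of a sum. But the coherence map of finite sets that acts
  on the vertices has a counterpart acting on the edges. Along a bijection of vertices \<open>push_vec\<close> merely transports the inflow
  (\<open>push_vec_bij\<close>), so this counterpart is a relabelling from one side of the diagram to the other
  (\<open>relabelling_assoc\<close>, \<open>relabelling_lunit\<close>, \<open>relabelling_runit\<close>, \<open>relabelling_braid\<close>).

  Pushing forward and summing send relabelled networks to relabelled networks, so both descend to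
  classes, where they can be computed on representatives (\<open>class_map_class\<close>, \<open>class_sum_class\<close>);
  every axiom then reduces to a statement about networks just described.
\<close>

section \<open>Categories of sets\<close>

text \<open>
  The finite sets and the sets differ only in which sets are objects and in the monoidal
  structure, so the category laws and a calculus of arrows are developed for both at once. Writing
  each arrow as \<open>mk_map A B f\<close> turns an equation between arrows into a pointwise one on \<open>A\<close>.
\<close>

locale category_of_sets =
  fixes C :: "('u set, 'u set_map) sm_cat"
  assumes arr_iff: "f \<in> Arr C \<longleftrightarrow> src f \<in> Obj C \<and> tgt f \<in> Obj C \<and> fn f \<in> src f \<rightarrow>\<^sub>E tgt f"
    and dom_eq: "Dom C = src"
    and cod_eq: "Cod C = tgt"
    and ident_eq: "Ident C = (\<lambda>A. mk_map A A id)"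
    and comp_eq: "Comp C = (\<lambda>g f. mk_map (src f) (tgt g) (fn g \<circ> fn f))"
begin

lemma hom_iff:
  "f \<in> Hom C A B \<longleftrightarrow> A \<in> Obj C \<and> B \<in> Obj C \<and> (\<exists>g. g \<in> A \<rightarrow> B \<and> f = mk_map A B g)"
proof
  assume "f \<in> Hom C A B"
  then have "A \<in> Obj C" "B \<in> Obj C" "fn f \<in> A \<rightarrow>\<^sub>E B" "src f = A" "tgt f = B"
    by (auto simp: Hom_def arr_iff dom_eq cod_eq)
  moreover from this have "f = mk_map A B (fn f)"
    by (cases f) (auto simp: mk_map_def)
  ultimately show "A \<in> Obj C \<and> B \<in> Obj C \<and> (\<exists>g. g \<in> A \<rightarrow> B \<and> f = mk_map A B g)"
    by (metis PiE_def IntE)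
qed (auto simp: Hom_def arr_iff dom_eq cod_eq mk_map_def)

lemma mk_map_hom:
  assumes "A \<in> Obj C" "B \<in> Obj C" "f \<in> A \<rightarrow> B"
  shows "mk_map A B f \<in> Hom C A B"
  using assms by (auto simp: hom_iff)

lemma homE:
  assumes "f \<in> Hom C A B"
  obtains g where "A \<in> Obj C" "B \<in> Obj C" "g \<in> A \<rightarrow> B" "f = mk_map A B g"
  using assms by (auto simp: hom_iff)

lemma comp_mk_map:
  assumes "f \<in> A \<rightarrow> B"
  shows "Comp C (mk_map B D g) (mk_map A B f) = mk_map A D (\<lambda>x. g (f x))"
  using assms by (auto simp: comp_eq mk_map_def fun_eq_iff restrict_def)

text \<open>
  The associativity and unit diagrams of a lax monoidal functor involve composites of three arrows.
  Stating the rule for three at once lets the simplifier check the middle objects without having to compose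
  membership in function spaces.
\<close>

lemma comp_comp_mk_map:
  assumes "f \<in> A \<rightarrow> B" "g \<in> B \<rightarrow> D"
  shows "Comp C (mk_map D E h) (Comp C (mk_map B D g) (mk_map A B f)) =
    mk_map A E (\<lambda>x. h (g (f x)))"
  using assms by (simp add: comp_mk_map Pi_iff)

lemma ident_mk_map: "Ident C A = mk_map A A (\<lambda>x. x)"
  by (simp add: ident_eq id_def)

lemma iso_arrow_mk_map:
  assumes "A \<in> Obj C" "B \<in> Obj C" "f \<in> A \<rightarrow> B" "g \<in> B \<rightarrow> A"
    and "\<And>x. x \<in> A \<Longrightarrow> g (f x) = x" "\<And>y. y \<in> B \<Longrightarrow> f (g y) = y"
  shows "iso_arrow C A B (mk_map A B f)"
proof -
  have "mk_map A B f \<in> Hom C A B" "mk_map B A g \<in> Hom C B A"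
    using assms by (auto intro: mk_map_hom)
  moreover have "Comp C (mk_map B A g) (mk_map A B f) = Ident C A"
    "Comp C (mk_map A B f) (mk_map B A g) = Ident C B"
    using assms by (simp_all add: comp_mk_map ident_mk_map) (auto simp: mk_map_def)
  ultimately show ?thesis
    unfolding iso_arrow_def by blast
qed

end

lemma mk_map_eqI:
  assumes "\<And>x. x \<in> A \<Longrightarrow> f x = g x"
  shows "mk_map A B f = mk_map A B g"
  using assms by (auto simp: mk_map_def)

lemma mk_map_sel [simp]:
  "src (mk_map A B f) = A" "tgt (mk_map A B f) = B" "x \<in> A \<Longrightarrow> fn (mk_map A B f) x = f x"
  by (simp_all add: mk_map_def)

sublocale category_of_sets \<subseteq> category C
proof
  fix f X Y assume "f \<in> Hom C X Y"
  then show "Comp C (Ident C Y) f = f" "Comp C f (Ident C X) = f"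
    by (auto elim!: homE simp: comp_mk_map ident_mk_map)
next
  fix f g h X Y Z W assume "f \<in> Hom C X Y" "g \<in> Hom C Y Z" "h \<in> Hom C Z W"
  then show "Comp C h (Comp C g f) = Comp C (Comp C h g) f"
    by (auto elim!: homE simp: comp_mk_map Pi_iff)
next
  fix f g X Y Z assume "f \<in> Hom C X Y" "g \<in> Hom C Y Z"
  then show "Comp C g f \<in> Hom C X Z"
    by (auto elim!: homE intro!: mk_map_hom simp: comp_mk_map Pi_iff)
qed (auto simp: arr_iff dom_eq cod_eq ident_mk_map intro!: mk_map_hom)

section \<open>Finite sets with disjoint union\<close>

lemma copair_simps [simp]:
  "copair f g (Lft x) = f x" "copair f g (Rgt y) = g y" "copair f g (Atom a) = undefined"
  by (simp_all add: copair_def)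

lemma disj_sum_mem [simp]:
  "Lft x \<in> disj_sum A B \<longleftrightarrow> x \<in> A" "Rgt y \<in> disj_sum A B \<longleftrightarrow> y \<in> B" "Atom a \<notin> disj_sum A B"
  by (auto simp: disj_sum_def)

lemma ball_disj_sum [simp]:
  "(\<forall>x\<in>disj_sum A B. P x) \<longleftrightarrow> (\<forall>x\<in>A. P (Lft x)) \<and> (\<forall>y\<in>B. P (Rgt y))"
  by (auto simp: disj_sum_def)

lemma disj_sumE [elim!]:
  assumes "u \<in> disj_sum A B"
  obtains x where "u = Lft x" "x \<in> A" | y where "u = Rgt y" "y \<in> B"
  using assms by (auto simp: disj_sum_def)

lemma finite_disj_sum [simp]: "finite (disj_sum A B) \<longleftrightarrow> finite A \<and> finite B"
  by (auto simp: disj_sum_def finite_image_iff inj_on_def)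

lemma sum_coherence_simps [simp]:
  "sum_assoc (Lft (Lft x)) = Lft x" "sum_assoc (Lft (Rgt y)) = Rgt (Lft y)"
  "sum_assoc (Rgt z) = Rgt (Rgt z)"
  "sum_lunit (Rgt x) = x" "sum_runit (Lft x) = x"
  "sum_swap (Lft x) = Rgt x" "sum_swap (Rgt x) = Lft x"
  by (simp_all add: sum_assoc_def sum_lunit_def sum_runit_def sum_swap_def)

lemma FinSet_simps:
  "Obj FinSet = {A. finite A}"
  "Tensor FinSet = disj_sum"
  "Unit FinSet = {}"
  "Assoc FinSet A B D = mk_map (disj_sum (disj_sum A B) D) (disj_sum A (disj_sum B D)) sum_assoc"
  "LUnit FinSet A = mk_map (disj_sum {} A) A sum_lunit"
  "RUnit FinSet A = mk_map (disj_sum A {}) A sum_runit"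
  "Braid FinSet A B = mk_map (disj_sum A B) (disj_sum B A) sum_swap"
  by (simp_all add: FinSet_def)

lemma FinSet_tensor_mk_map:
  "TensorArr FinSet (mk_map A A' f) (mk_map B B' g) =
    mk_map (disj_sum A B) (disj_sum A' B') (copair (\<lambda>x. Lft (f x)) (\<lambda>y. Rgt (g y)))"
  by (auto simp: FinSet_def intro!: mk_map_eqI)

global_interpretation FinSet: category_of_sets FinSet
  by unfold_locales (auto simp: FinSet_def)

lemmas FinSet_calculus =
  FinSet_simps FinSet_tensor_mk_map FinSet.comp_mk_map FinSet.ident_mk_map Pi_iff

lemma FinSet_symmetric_monoidal: "symmetric_monoidal_category FinSet"
proof (unfold_locales, goal_cases)
  case (6 X Y Z)
  show ?case
    unfolding FinSet_simps
    \<comment> \<open>the inverse associator\<close>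
    by (rule FinSet.iso_arrow_mk_map
          [where g = "copair (\<lambda>x. Lft (Lft x)) (copair (\<lambda>y. Lft (Rgt y)) Rgt)"])
      (use 6 in \<open>auto simp: FinSet_simps\<close>)
next
  case (8 X)
  show ?case
    unfolding FinSet_simps
    \<comment> \<open>the left unitor is inverse to the right injection, the left summand being empty\<close>
    by (rule FinSet.iso_arrow_mk_map [where g = Rgt]) (use 8 in \<open>auto simp: FinSet_simps\<close>)
next
  case (10 X)
  show ?case
    unfolding FinSet_simps
    \<comment> \<open>the right unitor is inverse to the left injection\<close>
    by (rule FinSet.iso_arrow_mk_map [where g = Lft]) (use 10 in \<open>auto simp: FinSet_simps\<close>)
qed (auto elim!: FinSet.homE intro!: FinSet.mk_map_hom mk_map_eqI simp: FinSet_calculus)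

section \<open>Sets with Cartesian product\<close>

lemma cart_prod_mem [simp]: "PairOf a b \<in> cart_prod A B \<longleftrightarrow> a \<in> A \<and> b \<in> B"
  by (auto simp: cart_prod_def)

lemma ball_cart_prod [simp]:
  "(\<forall>u\<in>cart_prod A B. P u) \<longleftrightarrow> (\<forall>a\<in>A. \<forall>b\<in>B. P (PairOf a b))"
  by (auto simp: cart_prod_def)

lemma cart_prodE [elim!]:
  assumes "u \<in> cart_prod A B"
  obtains a b where "u = PairOf a b" "a \<in> A" "b \<in> B"
  using assms by (auto simp: cart_prod_def)

lemma SetCat_simps:
  "Obj SetCat = UNIV"
  "Tensor SetCat = cart_prod"
  "Unit SetCat = {Star}"
  "Assoc SetCat A B D =
    mk_map (cart_prod (cart_prod A B) D) (cart_prod A (cart_prod B D)) pair_assoc"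
  "LUnit SetCat A = mk_map (cart_prod {Star} A) A pair_snd"
  "RUnit SetCat A = mk_map (cart_prod A {Star}) A pair_fst"
  "Braid SetCat A B = mk_map (cart_prod A B) (cart_prod B A) pair_swap"
  by (simp_all add: SetCat_def)

lemma SetCat_tensor_mk_map:
  "TensorArr SetCat (mk_map A A' f) (mk_map B B' g) =
    mk_map (cart_prod A B) (cart_prod A' B') (pair_map f g)"
  by (auto simp: SetCat_def intro!: mk_map_eqI)

global_interpretation SetCat: category_of_sets SetCat
  by unfold_locales (auto simp: SetCat_def)

lemmas SetCat_calculus =
  SetCat_simps SetCat_tensor_mk_map SetCat.comp_mk_map SetCat.ident_mk_map Pi_iff

lemma SetCat_symmetric_monoidal: "symmetric_monoidal_category SetCat"
proof (unfold_locales, goal_cases)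
  case (6 X Y Z)
  show ?case
    unfolding SetCat_simps
    \<comment> \<open>the inverse associator\<close>
    by (rule SetCat.iso_arrow_mk_map [where g = "\<lambda>u. PairOf
          (PairOf (pair_fst u) (pair_fst (pair_snd u))) (pair_snd (pair_snd u))"])
      (auto simp: SetCat_simps)
next
  case (8 X)
  show ?case
    unfolding SetCat_simps
    \<comment> \<open>the unitors are inverted by pairing with the point\<close>
    by (rule SetCat.iso_arrow_mk_map [where g = "PairOf Star"]) (auto simp: SetCat_simps)
next
  case (10 X)
  show ?case
    unfolding SetCat_simps
    by (rule SetCat.iso_arrow_mk_map [where g = "\<lambda>x. PairOf x Star"]) (auto simp: SetCat_simps)
qed (auto elim!: SetCat.homE intro!: SetCat.mk_map_hom mk_map_eqI simp: SetCat_calculus)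

section \<open>Pushing forward and summing flow networks\<close>

lemma flow_networksD:
  assumes "F \<in> flow_networks N"
  shows "finite (edges F)"
    and "e \<in> edges F \<Longrightarrow> source F e \<in> N"
    and "e \<in> edges F \<Longrightarrow> target F e \<in> N"
    and "e \<in> edges F \<Longrightarrow> cost F e \<in> edge_costs"
    and "source F \<in> extensional (edges F)"
    and "target F \<in> extensional (edges F)"
    and "cost F \<in> extensional (edges F)"
    and "inflow F \<in> extensional N"
    and "(\<Sum>n\<in>N. inflow F n) = 0"
  using assms by (auto simp: flow_networks_def PiE_iff)

text \<open>
  The fibre of a composite over \<open>j\<close> is the disjoint union of the fibres of the first map over the
  points of the fibre of the second, so summing over it can be done in two stages.
\<close>

lemma push_vec_comp:
  assumes "finite N" "finite M" "f \<in> N \<rightarrow> M" "g \<in> M \<rightarrow> L"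
  shows "push_vec (mk_map N L (\<lambda>i. g (f i))) x =
    push_vec (mk_map M L g) (push_vec (mk_map N M f) x)"
proof (rule ext)
  fix j
  have "(\<Sum>i\<in>{i \<in> N. g (f i) = j}. x i) =
      (\<Sum>k\<in>{k \<in> M. g k = j}. \<Sum>i\<in>{i \<in> {i \<in> N. g (f i) = j}. f i = k}. x i)"
    using assms by (intro sum.group [symmetric]) auto
  also have "\<dots> = (\<Sum>k\<in>{k \<in> M. g k = j}. \<Sum>i\<in>{i \<in> N. f i = k}. x i)"
    by (intro sum.cong) auto
  finally show "push_vec (mk_map N L (\<lambda>i. g (f i))) x j =
      push_vec (mk_map M L g) (push_vec (mk_map N M f) x) j"
    by (simp add: push_vec_def cong: conj_cong)
qed

text \<open>
  The fibres partition the domain; this is why the inflows of a pushed network still add up to zero.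
\<close>

lemma sum_push_vec:
  assumes "finite N" "finite M" "f \<in> N \<rightarrow> M"
  shows "(\<Sum>j\<in>M. push_vec (mk_map N M f) x j) = (\<Sum>i\<in>N. x i)"
  using sum.group [of N M f x] assms
  by (simp add: push_vec_def image_subset_iff_funcset cong: conj_cong)

text \<open>
  The fibres of a bijection are single points, so the vector is only transported. All structural maps of
  \<^const>\<open>FinSet\<close> are bijections, and this is how the coherence diagrams treat the inflows.
\<close>

lemma push_vec_bij:
  assumes "bij_betw f N M" "y \<in> extensional M" "\<And>i. i \<in> N \<Longrightarrow> y (f i) = x i"
  shows "push_vec (mk_map N M f) x = y"
proof
  fix j
  show "push_vec (mk_map N M f) x j = y j"
  proof (cases "j \<in> M")
    case True
    then obtain i where "i \<in> N" "j = f i"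
      using assms(1) by (auto simp: bij_betw_def)
    moreover from this have "{i' \<in> N. f i' = j} = {i}"
      using assms(1) by (auto simp: bij_betw_def inj_on_def)
    ultimately show ?thesis
      using True assms(3) by (simp add: push_vec_def cong: conj_cong)
  qed (use assms(2) in \<open>auto simp: push_vec_def extensional_def\<close>)
qed

text \<open>
  A fibre of \<open>f + g\<close> is the copy of a fibre of \<open>f\<close> or of a fibre of \<open>g\<close>. This makes the product
  comparison natural.
\<close>

lemma push_vec_copair:
  "push_vec (mk_map (disj_sum N M) (disj_sum N' M') (copair (\<lambda>i. Lft (f i)) (\<lambda>i. Rgt (g i))))
      (copair x y) =
    copair (push_vec (mk_map N N' f) x) (push_vec (mk_map M M' g) y)"
proof
  fix u
  let ?h = "copair (\<lambda>i. Lft (f i)) (\<lambda>i. Rgt (g i))"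
  have "{u \<in> disj_sum N M. ?h u = Lft j} = Lft ` {i \<in> N. f i = j}" for j
    by auto
  moreover have "{u \<in> disj_sum N M. ?h u = Rgt j} = Rgt ` {i \<in> M. g i = j}" for j
    by auto
  ultimately show "push_vec (mk_map (disj_sum N M) (disj_sum N' M') ?h) (copair x y) u =
      copair (push_vec (mk_map N N' f) x) (push_vec (mk_map M M' g) y) u"
    by (cases u) (simp_all add: push_vec_def sum.reindex inj_on_def cong: conj_cong)
qed

lemma push_network_simps [simp]:
  "edges (push_network \<phi> F) = edges F"
  "e \<in> edges F \<Longrightarrow> source (push_network \<phi> F) e = fn \<phi> (source F e)"
  "e \<in> edges F \<Longrightarrow> target (push_network \<phi> F) e = fn \<phi> (target F e)"
  "cost (push_network \<phi> F) = cost F"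
  "inflow (push_network \<phi> F) = push_vec \<phi> (inflow F)"
  by (simp_all add: push_network_def)

lemma sum_network_simps [simp]:
  "edges (sum_network F G) = disj_sum (edges F) (edges G)"
  "e \<in> edges F \<Longrightarrow> source (sum_network F G) (Lft e) = Lft (source F e)"
  "e' \<in> edges G \<Longrightarrow> source (sum_network F G) (Rgt e') = Rgt (source G e')"
  "e \<in> edges F \<Longrightarrow> target (sum_network F G) (Lft e) = Lft (target F e)"
  "e' \<in> edges G \<Longrightarrow> target (sum_network F G) (Rgt e') = Rgt (target G e')"
  "cost (sum_network F G) = copair (cost F) (cost G)"
  "inflow (sum_network F G) = copair (inflow F) (inflow G)"
  by (simp_all add: sum_network_def)

text \<open>
  Sources and targets are determined by their values on the edges only because both are extensional.
\<close>

lemma network_eqI: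
  assumes "edges F = edges G"
    and "source F \<in> extensional (edges F)" "source G \<in> extensional (edges G)"
    and "target F \<in> extensional (edges F)" "target G \<in> extensional (edges G)"
    and "\<And>e. e \<in> edges F \<Longrightarrow> source F e = source G e"
    and "\<And>e. e \<in> edges F \<Longrightarrow> target F e = target G e"
    and "cost F = cost G" "inflow F = inflow G"
  shows "F = (G :: ('n, 'e) flow_network)"
proof (rule flow_network.equality)
  show "source F = source G" "target F = target G"
    using assms by (auto intro!: extensionalityI [where A = "edges F"])
qed (use assms in auto)

lemma push_network_extensional [simp]:
  "source (push_network \<phi> F) \<in> extensional (edges F)"
  "target (push_network \<phi> F) \<in> extensional (edges F)"
  by (simp_all add: push_network_def)

lemma sum_network_extensional [simp]:
  "source (sum_network F G) \<in> extensional (disj_sum (edges F) (edges G))"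
  "target (sum_network F G) \<in> extensional (disj_sum (edges F) (edges G))"
  by (simp_all add: sum_network_def)

lemma copair_extensional [simp]:
  assumes "x \<in> extensional A" "y \<in> extensional B"
  shows "copair x y \<in> extensional (disj_sum A B)"
  unfolding extensional_def
proof safe
  fix u assume "u \<notin> disj_sum A B"
  with assms show "copair x y u = undefined"
    by (cases u) (auto simp: extensional_def)
qed

lemma sum_copair:
  assumes "finite N" "finite M"
  shows "(\<Sum>u\<in>disj_sum N M. copair x y u) = (\<Sum>i\<in>N. x i) + (\<Sum>j\<in>M. y j)"
  unfolding disj_sum_def using assms
  by (subst sum.union_disjoint) (auto simp: sum.reindex inj_on_def)

lemma push_network_closed:
  assumes "\<phi> \<in> Hom FinSet N M" "F \<in> flow_networks N"
  shows "push_network \<phi> F \<in> flow_networks M"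
proof -
  obtain f where "finite N" "finite M" and f: "f \<in> N \<rightarrow> M" and \<phi>: "\<phi> = mk_map N M f"
    using assms(1) by (auto elim!: FinSet.homE simp: FinSet_simps)
  then have "(\<Sum>j\<in>M. push_vec \<phi> (inflow F) j) = 0"
    using flow_networksD(9)[OF assms(2)] by (simp add: sum_push_vec)
  moreover have "push_vec \<phi> (inflow F) \<in> extensional M"
    by (simp add: push_vec_def \<phi>)
  ultimately show ?thesis
    using flow_networksD[OF assms(2)] f
    unfolding flow_networks_def by (auto simp: PiE_iff \<phi>)
qed

lemma sum_network_closed:
  assumes "finite N" "finite M" "F \<in> flow_networks N" "G \<in> flow_networks M"
  shows "sum_network F G \<in> flow_networks (disj_sum N M)"
  using flow_networksD[OF assms(3)] flow_networksD[OF assms(4)] assms(1,2)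
  unfolding flow_networks_def by (auto simp: PiE_iff sum_copair)

lemma push_network_ident:
  assumes "F \<in> flow_networks N"
  shows "push_network (Ident FinSet N) F = F"
proof (rule network_eqI)
  show "inflow (push_network (Ident FinSet N) F) = inflow F"
    using flow_networksD[OF assms]
    by (auto simp: FinSet.ident_mk_map intro!: push_vec_bij bij_betw_imageI)
qed (use flow_networksD[OF assms] in \<open>auto simp: FinSet.ident_mk_map\<close>)

lemma push_network_comp:
  assumes "\<phi> \<in> Hom FinSet N M" "\<psi> \<in> Hom FinSet M L" "F \<in> flow_networks N"
  shows "push_network (Comp FinSet \<psi> \<phi>) F = push_network \<psi> (push_network \<phi> F)"
proof -
  obtain f g where fin: "finite N" "finite M" and fg: "f \<in> N \<rightarrow> M" "g \<in> M \<rightarrow> L"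
    and \<phi>\<psi>: "\<phi> = mk_map N M f" "\<psi> = mk_map M L g"
    using assms(1,2) by (auto elim!: FinSet.homE simp: FinSet_simps)
  note D = flow_networksD[OF assms(3)]
  show ?thesis
    unfolding \<phi>\<psi> FinSet.comp_mk_map[OF fg(1)]
  proof (rule network_eqI)
    show "inflow (push_network (mk_map N L (\<lambda>i. g (f i))) F) =
      inflow (push_network (mk_map M L g) (push_network (mk_map N M f) F))"
      by (simp add: push_vec_comp[OF fin fg])
    show "source (push_network (mk_map M L g) (push_network (mk_map N M f) F)) \<in>
        extensional (edges (push_network (mk_map M L g) (push_network (mk_map N M f) F)))"
      "target (push_network (mk_map M L g) (push_network (mk_map N M f) F)) \<in>
        extensional (edges (push_network (mk_map M L g) (push_network (mk_map N M f) F)))"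
      by (simp_all add: push_network_def)
  qed (use D fg in \<open>auto simp: Pi_iff\<close>)
qed

lemma push_network_tensor:
  assumes "\<phi> \<in> Hom FinSet N N'" "\<psi> \<in> Hom FinSet M M'"
    and "F \<in> flow_networks N" "G \<in> flow_networks M"
  shows "push_network (TensorArr FinSet \<phi> \<psi>) (sum_network F G) =
    sum_network (push_network \<phi> F) (push_network \<psi> G)"
proof -
  obtain f g where \<phi>\<psi>: "\<phi> = mk_map N N' f" "\<psi> = mk_map M M' g"
    using assms(1,2) by (auto elim!: FinSet.homE)
  show ?thesis
    unfolding \<phi>\<psi> FinSet_tensor_mk_map
    by (rule network_eqI)
      (use flow_networksD[OF assms(3)] flow_networksD[OF assms(4)] in
        \<open>auto simp: push_vec_copair push_network_def sum_network_def\<close>)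
qed

section \<open>Relabelling of edges\<close>

text \<open>
  The common pattern of the coherence diagrams: a bijection of vertices and a bijection of edges that
  together carry the data of \<open>F\<close> to those of \<open>F'\<close>. Since the inflow of \<open>F'\<close> is extensional, it is
  forced by its values at the images of the vertices of \<open>F\<close>.
\<close>

lemma relabellingI_push:
  assumes "bij_betw r (edges F) (edges F')" "bij_betw f N M"
    and "\<And>e. e \<in> edges F \<Longrightarrow> source F e \<in> N" "\<And>e. e \<in> edges F \<Longrightarrow> target F e \<in> N"
    and "\<And>e. e \<in> edges F \<Longrightarrow> source F' (r e) = f (source F e)"
    and "\<And>e. e \<in> edges F \<Longrightarrow> target F' (r e) = f (target F e)"
    and "\<And>e. e \<in> edges F \<Longrightarrow> cost F' (r e) = cost F e"
    and "inflow F' \<in> extensional M" "\<And>i. i \<in> N \<Longrightarrow> inflow F' (f i) = inflow F i"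
  shows "relabelling r (push_network (mk_map N M f) F) F'"
  using assms by (auto simp: relabelling_def push_vec_bij)

lemma bij_sum_assoc:
  "bij_betw sum_assoc (disj_sum (disj_sum A B) D) (disj_sum A (disj_sum B D))"
  by (rule bij_betw_byWitness [where f' = "copair (\<lambda>x. Lft (Lft x)) (copair (\<lambda>y. Lft (Rgt y)) Rgt)"])
    auto

lemma bij_sum_lunit: "bij_betw sum_lunit (disj_sum {} A) A"
  by (rule bij_betw_byWitness [where f' = Rgt]) auto

lemma bij_sum_runit: "bij_betw sum_runit (disj_sum A {}) A"
  by (rule bij_betw_byWitness [where f' = Lft]) auto

lemma bij_sum_swap: "bij_betw sum_swap (disj_sum A B) (disj_sum B A)"
  by (rule bij_betw_byWitness [where f' = sum_swap]) auto

text \<open>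
  The same function \<^const>\<open>sum_assoc\<close> acts on vertices and on edges: a source, say, is
  tagged with the summand of its edge, so retagging the edge retags the source in the same way.
  The unit and symmetry diagrams work alike.
\<close>

lemma relabelling_assoc:
  assumes "F \<in> flow_networks N" "G \<in> flow_networks M" "H \<in> flow_networks L"
  shows "relabelling sum_assoc
    (push_network (Assoc FinSet N M L) (sum_network (sum_network F G) H))
    (sum_network F (sum_network G H))"
  unfolding FinSet_simps
  using flow_networksD[OF assms(1)] flow_networksD[OF assms(2)] flow_networksD[OF assms(3)]
  by (intro relabellingI_push) (auto simp: bij_sum_assoc)

lemma edges_empty:
  assumes "Z \<in> flow_networks {}"
  shows "edges Z = {}"
  using flow_networksD(2)[OF assms] by blast

lemma relabelling_lunit:
  assumes "Z \<in> flow_networks {}" "F \<in> flow_networks N"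
  shows "relabelling sum_lunit (push_network (LUnit FinSet N) (sum_network Z F)) F"
  unfolding FinSet_simps using edges_empty[OF assms(1)] flow_networksD[OF assms(2)]
  by (intro relabellingI_push) (auto simp: bij_sum_lunit)

lemma relabelling_runit:
  assumes "Z \<in> flow_networks {}" "F \<in> flow_networks N"
  shows "relabelling sum_runit (push_network (RUnit FinSet N) (sum_network F Z)) F"
  unfolding FinSet_simps using edges_empty[OF assms(1)] flow_networksD[OF assms(2)]
  by (intro relabellingI_push) (auto simp: bij_sum_runit)

lemma relabelling_braid:
  assumes "F \<in> flow_networks N" "G \<in> flow_networks M"
  shows "relabelling sum_swap
    (push_network (Braid FinSet N M) (sum_network F G)) (sum_network G F)"
  unfolding FinSet_simps using flow_networksD[OF assms(1)] flow_networksD[OF assms(2)]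
  by (intro relabellingI_push) (auto simp: bij_sum_swap)

lemma equiv_relabel_rel: "equiv (flow_networks N) (relabel_rel N)"
proof (rule equivI)
  show "relabel_rel N \<subseteq> flow_networks N \<times> flow_networks N"
    by (auto simp: relabel_rel_def)
  have "relabelling id F F" for F
    by (simp add: relabelling_def)
  then show "refl_on (flow_networks N) (relabel_rel N)"
    by (auto simp: refl_on_def relabel_rel_def)
  have "relabelling (inv_into (edges F) r) F' F" if "relabelling r F F'" for r F F'
  proof -
    have "bij_betw r (edges F) (edges F')"
      using that by (simp add: relabelling_def)
    then have "r (inv_into (edges F) r e) = e \<and> inv_into (edges F) r e \<in> edges F"
      if "e \<in> edges F'" for e
      using that by (metis bij_betw_def f_inv_into_f inv_into_into)
    then show ?thesis
      using that unfolding relabelling_def by (metis bij_betw_inv_into)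
  qed
  then show "sym (relabel_rel N)"
    unfolding sym_def relabel_rel_def by blast
  have "relabelling (s \<circ> r) F H" if "relabelling r F G" "relabelling s G H" for r s F G H
    using that unfolding relabelling_def
    by (auto intro: bij_betw_trans) (metis bij_betwE)+
  then show "trans (relabel_rel N)"
    unfolding trans_def relabel_rel_def by blast
qed

lemma network_class_eqI:
  assumes "F \<in> flow_networks N" "G \<in> flow_networks N" "relabelling r F G"
  shows "network_class N F = network_class N G"
  unfolding network_class_def
  by (rule equiv_class_eq[OF equiv_relabel_rel]) (use assms in \<open>auto simp: relabel_rel_def\<close>)

lemma push_network_relabelling:
  assumes "relabelling r F F'"
  shows "relabelling r (push_network \<phi> F) (push_network \<phi> F')"
  using assms bij_betwE by (fastforce simp: relabelling_def)

text \<open>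
  Relabelling the two summands independently makes the sum of classes well defined.
\<close>

lemma sum_network_relabelling:
  assumes "relabelling r F F'" "relabelling s G G'"
  shows "relabelling (copair (\<lambda>e. Lft (r e)) (\<lambda>e. Rgt (s e))) (sum_network F G) (sum_network F' G')"
proof -
  have r: "bij_betw r (edges F) (edges F')" and s: "bij_betw s (edges G) (edges G')"
    using assms by (auto simp: relabelling_def)
  let ?h = "copair (\<lambda>e. Lft (r e)) (\<lambda>e. Rgt (s e))"
  have "bij_betw ?h (disj_sum (edges F) (edges G)) (disj_sum (edges F') (edges G'))"
    unfolding bij_betw_def
  proof
    show "inj_on ?h (disj_sum (edges F) (edges G))"
      using r s by (auto simp: bij_betw_def inj_on_def)
    show "?h ` disj_sum (edges F) (edges G) = disj_sum (edges F') (edges G')"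
      using r s by (auto simp: bij_betw_def disj_sum_def image_Un image_image)
  qed
  moreover have "r e \<in> edges F'" if "e \<in> edges F" for e
    using r that by (auto simp: bij_betw_def)
  moreover have "s e \<in> edges G'" if "e \<in> edges G" for e
    using s that by (auto simp: bij_betw_def)
  ultimately show ?thesis
    using assms by (auto simp: relabelling_def)
qed

section \<open>The functor on classes of networks\<close>

lemma FlowNet_iff:
  "u \<in> FlowNet N \<longleftrightarrow> (\<exists>F\<in>flow_networks N. u = Elem (network_class N F))"
  by (auto simp: FlowNet_def network_class_def quotient_def)

lemma FlowNetE:
  assumes "u \<in> FlowNet N"
  obtains F where "F \<in> flow_networks N" "u = Elem (network_class N F)"
  using assms by (auto simp: FlowNet_iff)

lemma network_class_in_FlowNet:
  "F \<in> flow_networks N \<Longrightarrow> Elem (network_class N F) \<in> FlowNet N"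
  by (auto simp: FlowNet_iff)

text \<open>
  The functions underlying the arrows \<^const>\<open>FlowNet_map\<close> and \<^const>\<open>FlowNet_prod\<close>, named so
  that the calculus of \<^const>\<open>mk_map\<close> applies to them without exposing the case distinctions.
\<close>

definition class_map :: "'a sum_univ set_map \<Rightarrow> ('a, 'e) network_univ \<Rightarrow> ('a, 'e) network_univ"
  where "class_map \<phi> u = (case u of
      Elem X \<Rightarrow> Elem (\<Union>F\<in>X. network_class (tgt \<phi>) (push_network \<phi> F)) | _ \<Rightarrow> undefined)"

definition class_sum :: "'a sum_univ set \<Rightarrow> 'a sum_univ set \<Rightarrow>
    ('a, 'e) network_univ \<Rightarrow> ('a, 'e) network_univ"
  where "class_sum N M u = (case u of
      PairOf (Elem X) (Elem Y) \<Rightarrow>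
        Elem (\<Union>F\<in>X. \<Union>G\<in>Y. network_class (disj_sum N M) (sum_network F G)) | _ \<Rightarrow> undefined)"

lemma FlowNet_map_eq:
  "FlowNet_map \<phi> = mk_map (FlowNet (src \<phi>)) (FlowNet (tgt \<phi>)) (class_map \<phi>)"
  by (simp add: FlowNet_map_def class_map_def [abs_def])

lemma FlowNet_prod_eq:
  "FlowNet_prod N M =
    mk_map (cart_prod (FlowNet N) (FlowNet M)) (FlowNet (disj_sum N M)) (class_sum N M)"
  by (simp add: FlowNet_prod_def class_sum_def [abs_def])

lemma class_map_class:
  assumes "\<phi> \<in> Hom FinSet N M" "F \<in> flow_networks N"
  shows "class_map \<phi> (Elem (network_class N F)) = Elem (network_class M (push_network \<phi> F))"
proof -
  have M: "tgt \<phi> = M"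
    using assms(1) by (auto elim: FinSet.homE)
  have "(\<lambda>F. network_class M (push_network \<phi> F)) respects relabel_rel N"
    by (rule congruentI, clarsimp simp: relabel_rel_def)
      (intro network_class_eqI[OF _ _ push_network_relabelling] push_network_closed[OF assms(1)])
  from UN_equiv_class[OF equiv_relabel_rel this assms(2)] show ?thesis
    by (simp add: class_map_def M network_class_def)
qed

lemma class_sum_class:
  assumes "finite N" "finite M" "F \<in> flow_networks N" "G \<in> flow_networks M"
  shows "class_sum N M (PairOf (Elem (network_class N F)) (Elem (network_class M G))) =
    Elem (network_class (disj_sum N M) (sum_network F G))"
proof -
  have "congruent2 (relabel_rel N) (relabel_rel M)
      (\<lambda>F G. network_class (disj_sum N M) (sum_network F G))"
    by (rule congruent2I', clarsimp simp: relabel_rel_def)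
      (intro network_class_eqI[OF _ _ sum_network_relabelling] sum_network_closed[OF assms(1,2)])
  from UN_equiv_class2[OF equiv_relabel_rel equiv_relabel_rel this assms(3,4)] show ?thesis
    by (simp add: class_sum_def network_class_def)
qed

text \<open>
  With no vertices there is nowhere for an edge to start, so the edge set is empty; extensionality then
  leaves no choice for the remaining functions, and the empty sum of inflows is zero.
\<close>

lemma singleton_flow_networks_empty: "is_singleton (flow_networks {} :: ('n, 'e) flow_network set)"
proof -
  let ?Z = "\<lparr>edges = {}, source = \<lambda>_. undefined, target = \<lambda>_. undefined,
    cost = \<lambda>_. undefined, inflow = \<lambda>_. undefined\<rparr> :: ('n, 'e) flow_network"
  have "F = ?Z" if "F \<in> flow_networks {}" for F :: "('n, 'e) flow_network"
  proof (rule flow_network.equality)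
    have "edges F = {}"
      using flow_networksD(2)[OF that] by blast
    then show "edges F = edges ?Z" "source F = source ?Z" "target F = target ?Z"
      "cost F = cost ?Z" "inflow F = inflow ?Z"
      using flow_networksD(5-8)[OF that] by simp_all
  qed simp
  moreover have "?Z \<in> flow_networks {}"
    by (simp add: flow_networks_def)
  ultimately show ?thesis
    by (auto simp: is_singleton_def)
qed

lemma ex_empty_network:
  obtains Z :: "('a, 'e) network" where "Z \<in> flow_networks {}"
    and "FlowNet {} = {Elem (network_class {} Z)}"
proof -
  obtain Z :: "('a, 'e) network" where "flow_networks {} = {Z}"
    using singleton_flow_networks_empty by (auto simp: is_singleton_def)
  moreover from this have "FlowNet {} = {Elem (network_class {} Z)}"
    by (auto simp: FlowNet_iff)
  ultimately show thesis
    using that by blast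
qed

lemma SetCat_unique_hom_to_singleton:
  assumes "f \<in> Hom SetCat A {b}"
  shows "f = mk_map A {b} (\<lambda>_. b)"
  using assms by (auto elim!: SetCat.homE intro!: mk_map_eqI)

lemma ex1_hom_FlowNet_empty:
  "\<exists>!f. f \<in> Hom SetCat {Star} (FlowNet {} :: ('a, 'e) network_univ set)"
proof (rule ex_empty_network)
  fix Z :: "('a, 'e) network"
  assume *: "FlowNet {} = {Elem (network_class {} Z)}"
  show ?thesis
    unfolding *
  proof (rule ex1I)
    show "mk_map {Star} {Elem (network_class {} Z)} (\<lambda>_. Elem (network_class {} Z))
        \<in> Hom SetCat {Star} {Elem (network_class {} Z)}"
      by (rule SetCat.mk_map_hom) (auto simp: SetCat_simps)
  qed (rule SetCat_unique_hom_to_singleton)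
qed

lemma FlowNet_unit_eq:
  assumes "Z \<in> flow_networks {}"
  shows "FlowNet_unit = mk_map {Star} (FlowNet {}) (\<lambda>_. Elem (network_class {} Z))"
  unfolding FlowNet_unit_def
  by (rule the1_equality[OF ex1_hom_FlowNet_empty], rule SetCat.mk_map_hom)
    (use assms in \<open>auto simp: SetCat_simps network_class_in_FlowNet\<close>)

lemma class_map_closed:
  assumes "\<phi> \<in> Hom FinSet N M"
  shows "class_map \<phi> \<in> FlowNet N \<rightarrow> FlowNet M"
  using assms
  by (auto elim!: FlowNetE simp: class_map_class network_class_in_FlowNet push_network_closed)

lemma class_sum_closed:
  assumes "finite N" "finite M"
  shows "class_sum N M \<in> cart_prod (FlowNet N) (FlowNet M) \<rightarrow> FlowNet (disj_sum N M)"
  using assms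
  by (auto elim!: FlowNetE simp: class_sum_class network_class_in_FlowNet sum_network_closed)

lemma FlowNet_map_hom:
  assumes "\<phi> \<in> Hom FinSet N M"
  shows "FlowNet_map \<phi> = mk_map (FlowNet N) (FlowNet M) (class_map \<phi>)"
  using assms by (auto simp: FlowNet_map_eq elim!: FinSet.homE)

lemma pair_map_closed:
  assumes "f \<in> A \<rightarrow> A'" "g \<in> B \<rightarrow> B'"
  shows "pair_map f g \<in> cart_prod A B \<rightarrow> cart_prod A' B'"
  using assms by (auto simp: Pi_iff)

lemma FinSet_coherence_hom:
  assumes "finite X" "finite Y" "finite Z"
  shows "Assoc FinSet X Y Z \<in> Hom FinSet (disj_sum (disj_sum X Y) Z) (disj_sum X (disj_sum Y Z))"
    and "LUnit FinSet X \<in> Hom FinSet (disj_sum {} X) X"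
    and "RUnit FinSet X \<in> Hom FinSet (disj_sum X {}) X"
    and "Braid FinSet X Y \<in> Hom FinSet (disj_sum X Y) (disj_sum Y X)"
  using assms unfolding FinSet_simps
  by (auto intro!: FinSet.mk_map_hom simp: FinSet_simps)

text \<open>
  The edge relabellings become equalities of classes, which is the form the axioms of a lax monoidal
  functor need.
\<close>

lemma network_class_coherence:
  assumes "finite X" "finite Y" "finite Z"
    and "F \<in> flow_networks X" "G \<in> flow_networks Y" "H \<in> flow_networks Z"
    and "E \<in> flow_networks {}"
  shows "network_class (disj_sum X (disj_sum Y Z))
      (push_network (Assoc FinSet X Y Z) (sum_network (sum_network F G) H)) =
      network_class (disj_sum X (disj_sum Y Z)) (sum_network F (sum_network G H))"
    and "network_class X (push_network (LUnit FinSet X) (sum_network E F)) = network_class X F"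
    and "network_class X (push_network (RUnit FinSet X) (sum_network F E)) = network_class X F"
    and "network_class (disj_sum Y X) (push_network (Braid FinSet X Y) (sum_network F G)) =
      network_class (disj_sum Y X) (sum_network G F)"
proof -
  note t = FinSet_coherence_hom[OF assms(1-3)]
  note closed = push_network_closed sum_network_closed assms finite_disj_sum[THEN iffD2]
    finite.emptyI conjI
  show "network_class (disj_sum X (disj_sum Y Z))
      (push_network (Assoc FinSet X Y Z) (sum_network (sum_network F G) H)) =
      network_class (disj_sum X (disj_sum Y Z)) (sum_network F (sum_network G H))"
    by (rule network_class_eqI[OF _ _ relabelling_assoc]) (rule closed t(1))+
  show "network_class X (push_network (LUnit FinSet X) (sum_network E F)) = network_class X F"
    by (rule network_class_eqI[OF _ _ relabelling_lunit]) (rule closed t(2))+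
  show "network_class X (push_network (RUnit FinSet X) (sum_network F E)) = network_class X F"
    by (rule network_class_eqI[OF _ _ relabelling_runit]) (rule closed t(3))+
  show "network_class (disj_sum Y X) (push_network (Braid FinSet X Y) (sum_network F G)) =
      network_class (disj_sum Y X) (sum_network G F)"
    by (rule network_class_eqI[OF _ _ relabelling_braid]) (rule closed t(4))+
qed

text \<open>
  The two sides of each equational axiom are composites of arrows \<open>mk_map\<close>, hence single arrows
  between the same sets. They are compared at classes of networks, where the strict equations or the
  coherence of classes apply.
\<close>

theorem FlowNet_lax_symmetric_monoidal:
  "lax_symmetric_monoidal_functor FinSet SetCat FlowNet FlowNet_map FlowNet_unit
    (FlowNet_prod :: 'a sum_univ set \<Rightarrow> 'a sum_univ set \<Rightarrow> ('a, 'e) network_univ set_map)"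
proof -
  interpret FS: symmetric_monoidal_category "FinSet :: ('a sum_univ set, _) sm_cat"
    by (rule FinSet_symmetric_monoidal)
  interpret SC: symmetric_monoidal_category "SetCat :: (('a, 'e) network_univ set, _) sm_cat"
    by (rule SetCat_symmetric_monoidal)
  obtain E :: "('a, 'e) network" where E: "E \<in> flow_networks {}"
    using ex_empty_network by blast
  note closed = class_map_closed class_sum_closed pair_map_closed
  note on_classes = class_map_class class_sum_class push_network_closed sum_network_closed
  show ?thesis
  proof (unfold_locales, goal_cases)
    case (1 X)
    show ?case by (simp add: SetCat_simps)
  next
    case (2 \<phi> X Y)
    then show ?case
      by (simp add: FlowNet_map_hom SetCat.mk_map_hom class_map_closed SetCat_simps)
  next
    \<comment> \<open>identities\<close>
    case (3 X)
    note id = FinSet.ident_hom[OF 3]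
    show ?case
      unfolding FlowNet_map_hom[OF id] SetCat.ident_mk_map
      by (rule mk_map_eqI)
        (auto elim!: FlowNetE simp: class_map_class[OF id] push_network_ident)
  next
    \<comment> \<open>composition\<close>
    case (4 \<phi> X Y \<psi> Z)
    note c = FinSet.comp_hom[OF 4]
    show ?case
      unfolding FlowNet_map_hom[OF c] FlowNet_map_hom[OF 4(1)] FlowNet_map_hom[OF 4(2)]
        SetCat.comp_mk_map[OF class_map_closed[OF 4(1)]]
      by (rule mk_map_eqI)
        (use 4 in \<open>auto elim!: FlowNetE simp: on_classes class_map_class[OF c] push_network_comp\<close>)
  next
    case 5
    show ?case
      unfolding FlowNet_unit_def FinSet_simps SetCat_simps
      by (rule theI'[OF ex1_hom_FlowNet_empty])
  next
    case (6 X Y)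
    then show ?case
      by (simp add: FlowNet_prod_eq SetCat.mk_map_hom class_sum_closed SetCat_simps FinSet_simps)
  next
    \<comment> \<open>naturality of the product comparison\<close>
    case (7 \<phi> X X' \<psi> Y Y')
    have fin: "finite X" "finite X'" "finite Y" "finite Y'"
      using 7 by (auto elim!: FinSet.homE simp: FinSet_simps)
    note t = FS.tensor_hom[OF 7, unfolded FinSet_simps]
    show ?case
      unfolding FlowNet_map_hom[OF t] FlowNet_map_hom[OF 7(1)] FlowNet_map_hom[OF 7(2)]
        FlowNet_prod_eq SetCat_tensor_mk_map SetCat.comp_mk_map[OF class_sum_closed[OF fin(1,3)]]
        SetCat.comp_mk_map[OF pair_map_closed[OF class_map_closed[OF 7(1)] class_map_closed[OF 7(2)]]]
      by (rule mk_map_eqI)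
        (use fin 7 in \<open>auto elim!: FlowNetE simp: on_classes class_map_class[OF t]
          push_network_tensor\<close>)
  next
    \<comment> \<open>associativity diagram\<close>
    case (8 X Y Z)
    then have fin: "finite X" "finite Y" "finite Z"
      by (auto simp: FinSet_simps)
    note t = FinSet_coherence_hom[OF fin]
    have "pair_assoc \<in> cart_prod (cart_prod (FlowNet X) (FlowNet Y)) (FlowNet Z) \<rightarrow>
        cart_prod (FlowNet X) (cart_prod (FlowNet Y) (FlowNet Z) :: ('a, 'e) network_univ set)"
      by auto
    then show ?case
      unfolding SetCat_simps(2,4) FinSet_simps(2) FlowNet_map_hom[OF t(1)] FlowNet_prod_eq
        SetCat.ident_mk_map SetCat_tensor_mk_map
      by (simp add: SetCat.comp_comp_mk_map closed fin del: pair_map.simps)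
        (use fin in \<open>auto elim!: FlowNetE intro!: mk_map_eqI simp: on_classes
          class_map_class[OF t(1)] network_class_coherence(1)[OF fin _ _ _ E]\<close>)
  next
    \<comment> \<open>left unit diagram; the chosen empty network represents the unit comparison\<close>
    case (9 X)
    then have fin: "finite X" by (simp add: FinSet_simps)
    note t = FinSet_coherence_hom[OF fin fin fin]
    have "(\<lambda>_. Elem (network_class {} E)) \<in> {Star} \<rightarrow> FlowNet {}"
      using E by (auto simp: network_class_in_FlowNet)
    then show ?case
      unfolding SetCat_simps(2,3,5) FinSet_simps(2,3) FlowNet_map_hom[OF t(2)] FlowNet_prod_eq
        SetCat.ident_mk_map SetCat_tensor_mk_map FlowNet_unit_eq[OF E]
      by (simp add: SetCat.comp_comp_mk_map closed fin)
        (use fin E in \<open>auto elim!: FlowNetE intro!: mk_map_eqI simp: on_classes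
          class_map_class[OF t(2)] network_class_coherence(2)[OF fin fin fin]\<close>)
  next
    \<comment> \<open>right unit diagram\<close>
    case (10 X)
    then have fin: "finite X" by (simp add: FinSet_simps)
    note t = FinSet_coherence_hom[OF fin fin fin]
    have "(\<lambda>_. Elem (network_class {} E)) \<in> {Star} \<rightarrow> FlowNet {}"
      using E by (auto simp: network_class_in_FlowNet)
    then show ?case
      unfolding SetCat_simps(2,3,6) FinSet_simps(2,3) FlowNet_map_hom[OF t(3)] FlowNet_prod_eq
        SetCat.ident_mk_map SetCat_tensor_mk_map FlowNet_unit_eq[OF E]
      by (simp add: SetCat.comp_comp_mk_map closed fin)
        (use fin E in \<open>auto elim!: FlowNetE intro!: mk_map_eqI simp: on_classes
          class_map_class[OF t(3)] network_class_coherence(3)[OF fin fin fin]\<close>)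
  next
    \<comment> \<open>symmetry diagram\<close>
    case (11 X Y)
    then have fin: "finite X" "finite Y" by (simp_all add: FinSet_simps)
    note t = FinSet_coherence_hom[OF fin fin(1)]
    have "pair_swap \<in> cart_prod (FlowNet X) (FlowNet Y) \<rightarrow>
        cart_prod (FlowNet Y) (FlowNet X :: ('a, 'e) network_univ set)"
      by auto
    then show ?case
      unfolding SetCat_simps(2,7) FinSet_simps(2) FlowNet_map_hom[OF t(4)] FlowNet_prod_eq
      by (simp add: SetCat.comp_mk_map closed fin)
        (use fin E in \<open>auto elim!: FlowNetE intro!: mk_map_eqI simp: on_classes
          class_map_class[OF t(4)] network_class_coherence(4)[OF fin fin(1)]\<close>)
  qed
qed

theorem lemma6p1:
  shows
    "lax_symmetric_monoidal_functor
       (FinSet :: ('a sum_univ set, 'a sum_univ set_map) sm_cat)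
       (SetCat :: (('a, 'e) network_univ set, ('a, 'e) network_univ set_map) sm_cat)
       FlowNet FlowNet_map FlowNet_unit FlowNet_prod
     \<and> is_singleton (flow_networks {} :: ('a, 'e) network set)
     \<and> is_singleton (FlowNet {} :: ('a, 'e) network_univ set)
     \<and> (\<exists>!f. f \<in> Hom SetCat {Star} (FlowNet {} :: ('a, 'e) network_univ set))
     \<and> (\<forall>N::'a sum_univ set. finite N \<longrightarrow>
          equiv (flow_networks N :: ('a, 'e) network set) (relabel_rel N))
     \<and> (\<forall>(N::'a sum_univ set) M \<phi> (F::('a, 'e) network).
          \<phi> \<in> Hom FinSet N M \<and> F \<in> flow_networks N \<longrightarrow>
          push_network \<phi> F \<in> flow_networks M \<and>
          fn (FlowNet_map \<phi>) (Elem (network_class N F)) =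
            Elem (network_class M (push_network \<phi> F)))
     \<and> (\<forall>(N::'a sum_univ set) M (F::('a, 'e) network) G.
          finite N \<and> finite M \<and> F \<in> flow_networks N \<and> G \<in> flow_networks M \<longrightarrow>
          sum_network F G \<in> flow_networks (disj_sum N M) \<and>
          fn (FlowNet_prod N M) (PairOf (Elem (network_class N F)) (Elem (network_class M G))) =
            Elem (network_class (disj_sum N M) (sum_network F G)))
     \<and> (\<forall>(N::'a sum_univ set) (F::('a, 'e) network).
          finite N \<and> F \<in> flow_networks N \<longrightarrow> push_network (Ident FinSet N) F = F)
     \<and> (\<forall>(N::'a sum_univ set) M L \<phi> \<psi> (F::('a, 'e) network).
          \<phi> \<in> Hom FinSet N M \<and> \<psi> \<in> Hom FinSet M L \<and> F \<in> flow_networks N \<longrightarrow>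
          push_network (Comp FinSet \<psi> \<phi>) F = push_network \<psi> (push_network \<phi> F))
     \<and> (\<forall>(N::'a sum_univ set) N' M M' \<phi> \<psi> (F::('a, 'e) network) G.
          \<phi> \<in> Hom FinSet N N' \<and> \<psi> \<in> Hom FinSet M M' \<and>
          F \<in> flow_networks N \<and> G \<in> flow_networks M \<longrightarrow>
          push_network (TensorArr FinSet \<phi> \<psi>) (sum_network F G) =
            sum_network (push_network \<phi> F) (push_network \<psi> G))
     \<and> (\<forall>(N::'a sum_univ set) M L (F::('a, 'e) network) G H.
          finite N \<and> finite M \<and> finite L \<and>
          F \<in> flow_networks N \<and> G \<in> flow_networks M \<and> H \<in> flow_networks L \<longrightarrow>
          relabelling sum_assoc
            (push_network (Assoc FinSet N M L) (sum_network (sum_network F G) H))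
            (sum_network F (sum_network G H)))
     \<and> (\<forall>(N::'a sum_univ set) (Z::('a, 'e) network) F.
          finite N \<and> Z \<in> flow_networks {} \<and> F \<in> flow_networks N \<longrightarrow>
          relabelling sum_lunit (push_network (LUnit FinSet N) (sum_network Z F)) F \<and>
          relabelling sum_runit (push_network (RUnit FinSet N) (sum_network F Z)) F)
     \<and> (\<forall>(N::'a sum_univ set) M (F::('a, 'e) network) G.
          finite N \<and> finite M \<and> F \<in> flow_networks N \<and> G \<in> flow_networks M \<longrightarrow>
          relabelling sum_swap
            (push_network (Braid FinSet N M) (sum_network F G)) (sum_network G F))"
proof (intro conjI allI impI; (elim conjE)?)
  show "lax_symmetric_monoidal_functor FinSet SetCat FlowNet FlowNet_map FlowNet_unit
      (FlowNet_prod :: 'a sum_univ set \<Rightarrow> 'a sum_univ set \<Rightarrow> ('a, 'e) network_univ set_map)"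
    by (rule FlowNet_lax_symmetric_monoidal)
  show "is_singleton (FlowNet {} :: ('a, 'e) network_univ set)"
    by (metis ex_empty_network is_singletonI)
next
  fix N M :: "'a sum_univ set" and \<phi> and F :: "('a, 'e) network"
  assume *: "\<phi> \<in> Hom FinSet N M" "F \<in> flow_networks N"
  then show "fn (FlowNet_map \<phi>) (Elem (network_class N F)) =
      Elem (network_class M (push_network \<phi> F))"
    by (simp add: FlowNet_map_hom class_map_class network_class_in_FlowNet)
next
  fix N M :: "'a sum_univ set" and F G :: "('a, 'e) network"
  assume "finite N" "finite M" "F \<in> flow_networks N" "G \<in> flow_networks M"
  then show "fn (FlowNet_prod N M)
      (PairOf (Elem (network_class N F)) (Elem (network_class M G))) =
      Elem (network_class (disj_sum N M) (sum_network F G))"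
    by (simp add: FlowNet_prod_eq class_sum_class network_class_in_FlowNet)
qed (assumption | rule singleton_flow_networks_empty ex1_hom_FlowNet_empty equiv_relabel_rel
      push_network_closed sum_network_closed push_network_ident push_network_comp
      push_network_tensor relabelling_assoc relabelling_lunit relabelling_runit
      relabelling_braid)+

end
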